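(* Consider the system of ordinary differential equations, for $i\in\{1,\ldots,n\}$ and $t\ge0$, $$\begin{aligned} \dot X_{li} &= \Lambda^1_iB_{vi}^{\rm T},\\ \dot Y_i &= -A_{vi}^{\rm T}(A_{vi}Y_i-F_{vi})-\sum_{j=1}^n a_{i,j}(Y_i-Y_j)-\frac1n\Lambda^1_i-\sum_{j=1}^n a_{i,j}(\Lambda^2_i-\Lambda^2_j),\\ \dot Z_i &= -\sum_{j=1}^n a_{i,j}(\Lambda^1_i-\Lambda^1_j),\\ \dot\Lambda^1_i &= \frac1n(Y_i+\dot Y_i)-(X_{li}+\dot X_{li})B_{vi}+\sum_{j=1}^n a_{i,j}(Z_i-Z_j)-\sum_{j=1}^n a_{i,j}(\Lambda^1_i-\Lambda^1_j),\\ \dot\Lambda^2_i &= \sum_{j=1}^n a_{i,j}(Y_i-Y_j)+\sum_{j=1}^n a_{i,j}(\dot Y_i-\dot Y_j), \end{aligned}$$ where $\dot X_{li},\dot Y_i$ on the right-hand sides stand for the expressions in the first two lines, with state variables $X_{li}\in\mathbb R^{r\times p_i}$ and $Y_i,Z_i,\Lambda^1_i,\Lambda^2_i\in\mathbb R^{r\times q}$ and arbitrary initial conditions. If the undirected graph $\mathcal G$ is connected, then: 1) every equilibrium of this system is Lyapunov stable, and its trajectory is bounded for any initial condition; 2) the trajectory of this system is exponentially convergent, and $X(t)=[X_{l1}(t),\ldots,X_{ln}(t)]\in\mathbb R^{r\times p}$ converges exponentially to a least squares solution of $AXB=F$.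
   Context: $A\in\mathbb R^{m\times r}$, $B\in\mathbb R^{p\times q}$, $F\in\mathbb R^{m\times q}$ are partitioned (Row-Row-Row structure) as $A=[A_{v1}^{\rm T},\ldots,A_{vn}^{\rm T}]^{\rm T}$, $B=[B_{v1}^{\rm T},\ldots,B_{vn}^{\rm T}]^{\rm T}$, $F=[F_{v1}^{\rm T},\ldots,F_{vn}^{\rm T}]^{\rm T}$ with $A_{vi}\in\mathbb R^{m_i\times r}$, $B_{vi}\in\mathbb R^{p_i\times q}$, $F_{vi}\in\mathbb R^{m_i\times q}$, $\sum_i m_i=m$, $\sum_i p_i=p$. $\mathcal G$ is an undirected graph on $\{1,\ldots,n\}$ with symmetric adjacency matrix $[a_{i,j}]$, $a_{i,j}=a_{j,i}>0$ if $\{j,i\}$ is an edge and $a_{i,j}=0$ otherwise. A least squares solution to $AXB=F$ is a minimizer of $\|AXB-F\|_{\rm F}^2$ over $X\in\mathbb R^{r\times p}$. An equilibrium $z$ is Lyapunov stable if for every $\epsilon>0$ there is $\delta>0$ such that every solution starting in the open ball of radius $\delta$ about $z$ stays in the open ball of radius $\epsilon$ about $z$ for all $t\ge0$. A trajectory converges exponentially to $z^*$ if its distance to $z^*$ is at most $c\,e^{-\mu t}$ for some $c\ge0$, $\mu>0$ and all $t\ge0$; "exponentially convergent" means converging exponentially to some equilibrium (possibly depending on the initial condition). *)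

theory Defs
  imports "HOL-Analysis.Analysis"
begin

section \<open>Autonomous ordinary differential equations\<close>

definition solution :: "('s::real_normed_vector \<Rightarrow> 's) \<Rightarrow> (real \<Rightarrow> 's) \<Rightarrow> bool" where
  "solution f \<phi> \<longleftrightarrow> (\<forall>t\<ge>0. (\<phi> has_vector_derivative f (\<phi> t)) (at t within {0..}))"

definition equilibrium :: "('s::real_normed_vector \<Rightarrow> 's) \<Rightarrow> 's \<Rightarrow> bool" where
  "equilibrium f z \<longleftrightarrow> f z = 0"

definition lyapunov_stable :: "('s::real_normed_vector \<Rightarrow> 's) \<Rightarrow> 's \<Rightarrow> bool" where
  "lyapunov_stable f z \<longleftrightarrow>
     (\<forall>\<epsilon>>0. \<exists>\<delta>>0. \<forall>\<phi>. solution f \<phi> \<and> \<phi> 0 \<in> ball z \<delta> \<longrightarrow> (\<forall>t\<ge>0. \<phi> t \<in> ball z \<epsilon>))"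

definition converges_exponentially :: "(real \<Rightarrow> 's::metric_space) \<Rightarrow> 's \<Rightarrow> bool" where
  "converges_exponentially \<phi> z \<longleftrightarrow>
     (\<exists>c\<ge>0. \<exists>\<mu>>0. \<forall>t\<ge>0. dist (\<phi> t) z \<le> c * exp (- \<mu> * t))"


section \<open>Undirected weighted graphs on a finite vertex type\<close>

text \<open>Edges are unordered pairs of vertices. Loops are not excluded: the diagonal of the
  adjacency matrix never contributes to the dynamics.\<close>

definition undirected_graph :: "'n set set \<Rightarrow> bool" where
  "undirected_graph E \<longleftrightarrow> (\<forall>e\<in>E. \<exists>i j. e = {i, j})"

definition connected_graph :: "'n set set \<Rightarrow> bool" where
  "connected_graph E \<longleftrightarrow> (\<forall>i j. (\<lambda>u v. {u, v} \<in> E)\<^sup>*\<^sup>* i j)"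

definition adjacency_matrix :: "'n set set \<Rightarrow> real^'n^'n \<Rightarrow> bool" where
  "adjacency_matrix E a \<longleftrightarrow>
     (\<forall>i j. a $ i $ j = a $ j $ i) \<and>
     (\<forall>i j. if {j, i} \<in> E then a $ i $ j > 0 else a $ i $ j = 0)"

definition disagreement :: "real^'n^'n \<Rightarrow> ('n \<Rightarrow> 'v::real_vector) \<Rightarrow> 'n \<Rightarrow> 'v" where
  "disagreement a Y i = (\<Sum>j\<in>UNIV. (a $ i $ j) *\<^sub>R (Y i - Y j))"


section \<open>Block partitions\<close>

text \<open>A partition of the rows (or columns) of a matrix among the agents is given by the map
  sending each index to the agent owning it, so that the block of agent \<open>i\<close> has size
  \<open>card {k. own k = i}\<close> and these sizes add up to the number of rows (columns).
  The partition into consecutive blocks is the case of a monotone map; the order of the indices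
  plays no role.

  As block sizes vary with \<open>i\<close>, the block of agent \<open>i\<close> is represented inside the full matrix
  space, with zeros outside the indices owned by \<open>i\<close>. This embedding is isometric,
  and products and differences of blocks are those of the unpadded blocks.\<close>

definition row_block :: "('m \<Rightarrow> 'n) \<Rightarrow> real^'r^'m \<Rightarrow> 'n \<Rightarrow> real^'r^'m" where
  "row_block own M i = (\<chi> k l. if own k = i then M $ k $ l else 0)"

definition col_block :: "('p \<Rightarrow> 'n) \<Rightarrow> real^'p^'r \<Rightarrow> 'n \<Rightarrow> real^'p^'r" where
  "col_block own M i = (\<chi> k l. if own l = i then M $ k $ l else 0)"

text \<open>The matrix \<open>[M 1, \<dots>, M n]\<close>: column \<open>l\<close> is taken from the block of its owner.\<close>

definition join_cols :: "('p \<Rightarrow> 'n) \<Rightarrow> ('n \<Rightarrow> real^'p^'r) \<Rightarrow> real^'p^'r" where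
  "join_cols own M = (\<chi> k l. M (own l) $ k $ l)"


section \<open>Least squares solutions of \<open>A X B = F\<close>\<close>

text \<open>The norm of the library on nested vectors is the Frobenius norm:\<close>

lemma norm_matrix_frobenius:
  fixes M :: "real^'q^'m"
  shows "(norm M)\<^sup>2 = (\<Sum>k\<in>UNIV. \<Sum>l\<in>UNIV. (M $ k $ l)\<^sup>2)"
  by (simp add: norm_vec_def L2_set_def sum_nonneg)

definition least_squares_solution ::
    "real^'r^'m \<Rightarrow> real^'q^'p \<Rightarrow> real^'q^'m \<Rightarrow> real^'p^'r \<Rightarrow> bool" where
  "least_squares_solution A B F X \<longleftrightarrow>
     is_arg_min (\<lambda>X. (norm (A ** X ** B - F))\<^sup>2) (\<lambda>_. True) X"


section \<open>The distributed algorithm for the Row-Row-Row structure\<close>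

text \<open>States are tuples \<open>(X, Y, Z, \<Lambda>\<^sup>1, \<Lambda>\<^sup>2)\<close>. The matrices \<open>X\<^sub>l\<^sub>i\<close> are the column blocks of
  \<open>X\<close>; the other components are families of matrices indexed by the agents.\<close>

type_synonym ('n, 'p, 'q, 'r) state =
  "(real^'p^'r) \<times> (real^'q^'r^'n) \<times> (real^'q^'r^'n) \<times> (real^'q^'r^'n) \<times> (real^'q^'r^'n)"

definition rrr_field ::
    "real^'n^'n \<Rightarrow> ('m \<Rightarrow> 'n) \<Rightarrow> ('p \<Rightarrow> 'n) \<Rightarrow> real^'r^'m \<Rightarrow> real^'q^'p \<Rightarrow> real^'q^'m
      \<Rightarrow> ('n::finite, 'p::finite, 'q::finite, 'r::finite) state \<Rightarrow> ('n, 'p, 'q, 'r) state" where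
  "rrr_field a ownA ownB A B F = (\<lambda>(X, Y, Z, L1, L2).
     let n = real CARD('n);
         Av = row_block ownA A;
         Bv = row_block ownB B;
         Fv = row_block ownA F;
         Xl = col_block ownB X;
         dXl = (\<lambda>i. L1 $ i ** transpose (Bv i));
         dY = (\<lambda>i. - (transpose (Av i) ** (Av i ** Y $ i - Fv i))
                   - disagreement a (($) Y) i - (1 / n) *\<^sub>R L1 $ i - disagreement a (($) L2) i);
         dZ = (\<lambda>i. - disagreement a (($) L1) i);
         dL1 = (\<lambda>i. (1 / n) *\<^sub>R (Y $ i + dY i) - (Xl i + dXl i) ** Bv i
                    + disagreement a (($) Z) i - disagreement a (($) L1) i);
         dL2 = (\<lambda>i. disagreement a (($) Y) i + disagreement a dY i)
     in (join_cols ownB dXl, \<chi> i. dY i, \<chi> i. dZ i, \<chi> i. dL1 i, \<chi> i. dL2 i))"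

end

(*
  The algorithm is an affine flow v' = M v + b.  In the inner product g obtained from the standard
  one by adding the Hessian H of the objective to the Y-block, M is dissipative: the derivative
  feedback in the multiplier equations turns g(v, M v) into
  -<Y, H Y> - |dX|^2 - |dY|^2 - <L1, L L1> (L the graph Laplacian).  Hence equilibria are stable,
  and ker M is g-orthogonal to range M, so that the space splits into the two, and b lies in
  range M because it is g-orthogonal to ker M.  On range M a vector without dissipation has
  M v = (0, 0, 0, w, 0) with w nonzero, and there the form u(v) = <(M v)_L1, (M v)_Y> strictly
  decreases; by compactness (Finsler's lemma) kappa g + u is a strict quadratic Lyapunov function
  on range M for large kappa.  At an equilibrium the consensus of Y and L1 turns the sums of the
  block equations into the normal equation A^T (A X B - F) B^T = 0.
*)
theory Submission
  imports Defs
begin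

section \<open>Scalar differential inequalities on the half-line and a compactness argument\<close>

text \<open>The mean value argument uses the derivative only at interior points, where the one-sided
  derivative is two-sided; at \<open>0\<close> continuity suffices.\<close>

lemma nonincreasing_solution:
  fixes W W' :: "real \<Rightarrow> real"
  assumes W: "\<And>s. s \<ge> 0 \<Longrightarrow> (W has_vector_derivative W' s) (at s within {0..})"
    and W': "\<And>s. s \<ge> 0 \<Longrightarrow> W' s \<le> 0" and "t \<ge> 0"
  shows "W t \<le> W 0"
proof (rule DERIV_nonpos_imp_decreasing_open[OF \<open>t \<ge> 0\<close>])
  fix s assume "0 < s" "s < t"
  then have "at s within {0..} = at s"
    by (intro at_within_interior) (simp add: interior_real_atLeast)
  with W[of s] \<open>0 < s\<close> show "\<exists>y. DERIV W s :> y \<and> y \<le> 0"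
    by (intro exI[of _ "W' s"]) (simp add: has_real_derivative_iff_has_vector_derivative W')
next
  show "continuous_on {0..t} W"
    using W by (intro continuous_on_vector_derivative[of _ _ W'])
      (rule has_vector_derivative_within_subset[of _ _ _ "{0..}"], auto)
qed

text \<open>Multiplying by the integrating factor \<open>exp (\<mu> * t)\<close> reduces the claim
  to monotonicity.\<close>

lemma exponential_decay:
  fixes W W' :: "real \<Rightarrow> real"
  assumes W: "\<And>s. s \<ge> 0 \<Longrightarrow> (W has_vector_derivative W' s) (at s within {0..})"
    and W': "\<And>s. s \<ge> 0 \<Longrightarrow> W' s \<le> - \<mu> * W s" and "t \<ge> 0"
  shows "W t \<le> W 0 * exp (- \<mu> * t)"
proof -
  have "exp (\<mu> * t) * W t \<le> exp (\<mu> * 0) * W 0"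
  proof (rule nonincreasing_solution[OF _ _ \<open>t \<ge> 0\<close>])
    fix s :: real assume s: "s \<ge> 0"
    show "((\<lambda>s. exp (\<mu> * s) * W s) has_vector_derivative
        exp (\<mu> * s) * (\<mu> * W s + W' s)) (at s within {0..})"
      using W[OF s] unfolding has_real_derivative_iff_has_vector_derivative[symmetric]
      by (auto intro!: derivative_eq_intros simp: algebra_simps)
    show "exp (\<mu> * s) * (\<mu> * W s + W' s) \<le> 0"
      using W'[OF s] by (simp add: mult_le_0_iff)
  qed
  then have "exp (- \<mu> * t) * (exp (\<mu> * t) * W t) \<le> exp (- \<mu> * t) * W 0"
    by (intro mult_left_mono) auto
  then show ?thesis
    by (simp add: exp_minus field_simps)
qed

text \<open>Where \<open>q\<close> is not positive, \<open>p\<close> has a positive minimum by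
  compactness, so a large multiple of \<open>p\<close> outweighs \<open>q\<close> there; elsewhere
  both terms already have the right sign. A last minimum over \<open>K\<close> makes the bound
  uniform.\<close>

lemma finsler_compact:
  fixes p q :: "'s::topological_space \<Rightarrow> real"
  assumes K: "compact K" and p: "continuous_on K p" and q: "continuous_on K q"
    and p_nonneg: "\<And>z. z \<in> K \<Longrightarrow> p z \<ge> 0"
    and q_pos: "\<And>z. z \<in> K \<Longrightarrow> p z = 0 \<Longrightarrow> q z > 0"
  obtains \<kappa> c where "c > 0" "\<kappa> \<ge> 0" "\<And>z. z \<in> K \<Longrightarrow> \<kappa> * p z + q z \<ge> c"
proof (cases "K = {}")
  case True
  then show ?thesis using that[of 1 0] by auto
next
  case False
  obtain \<kappa> where \<kappa>: "\<kappa> \<ge> 0" "\<And>z. z \<in> K \<Longrightarrow> \<kappa> * p z + q z > 0"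
  proof (cases "{z \<in> K. q z \<le> 0} = {}")
    case True
    then show ?thesis using that[of 0] by force
  next
    case ne: False
    have "closedin (top_of_set K) {z \<in> K. q z \<le> 0}"
      using continuous_closedin_preimage[OF q closed_atMost[of 0]] by (simp add: vimage_def Int_def)
    then have K0: "compact {z \<in> K. q z \<le> 0}"
      using K closedin_compact by blast
    obtain x where x: "x \<in> K" "q x \<le> 0" "\<And>z. z \<in> K \<Longrightarrow> q z \<le> 0 \<Longrightarrow> p x \<le> p z"
      using continuous_attains_inf[OF K0 ne continuous_on_subset[OF p]] by auto
    obtain y where y: "y \<in> K" "\<And>z. z \<in> K \<Longrightarrow> q y \<le> q z"
      using continuous_attains_inf[OF K False q] by auto
    have px: "p x > 0"
      using p_nonneg[OF x(1)] q_pos[OF x(1)] x(2) by linarith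
    \<comment> \<open>Here \<open>p x\<close> is the least value of \<open>p\<close> on the set
      where \<open>q\<close> is not positive and \<open>q y\<close> the least value of
      \<open>q\<close> on \<open>K\<close>, so \<open>\<kappa> * p z\<close> is at least
      \<open>1 + \<bar>q y\<bar>\<close> on that set.\<close>
    define \<kappa> where "\<kappa> = (1 + \<bar>q y\<bar>) / p x"
    have \<kappa>: "\<kappa> \<ge> 0" using px by (simp add: \<kappa>_def)
    have "\<kappa> * p z + q z > 0" if z: "z \<in> K" for z
    proof (cases "q z \<le> 0")
      case True
      have "1 + \<bar>q y\<bar> = \<kappa> * p x" using px by (simp add: \<kappa>_def)
      also have "\<dots> \<le> \<kappa> * p z" using x(3)[OF z True] \<kappa> by (rule mult_left_mono)
      finally show ?thesis using y(2)[OF z] by linarith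
    next
      case False
      then show ?thesis using \<kappa> p_nonneg[OF z] by (simp add: add_nonneg_pos)
    qed
    with \<kappa> that show ?thesis by blast
  qed
  have "continuous_on K (\<lambda>z. \<kappa> * p z + q z)"
    by (intro continuous_intros p q)
  then obtain x where "x \<in> K" "\<And>z. z \<in> K \<Longrightarrow> \<kappa> * p x + q x \<le> \<kappa> * p z + q z"
    using continuous_attains_inf[OF K False] by blast
  with \<kappa> that show ?thesis by blast
qed

section \<open>Dissipative linear flows\<close>

lemma linear_coefficient_eq_0:
  fixes \<alpha> \<beta> :: real
  assumes "\<And>t. t * \<alpha> + t\<^sup>2 * \<beta> \<le> 0"
  shows "\<alpha> = 0"
proof -
  \<comment> \<open>At \<open>t = \<alpha> / s\<close> the quadratic equals
    \<open>\<alpha>\<^sup>2 * (s + \<beta>) / s\<^sup>2\<close>, and this \<open>s\<close> keeps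
    \<open>s + \<beta>\<close> positive.\<close>
  define s where "s = 1 + \<bar>\<beta>\<bar>"
  have s: "s > 0" "s + \<beta> > 0" by (auto simp: s_def)
  have "\<alpha>\<^sup>2 * (s + \<beta>) / s\<^sup>2 = (\<alpha> / s) * \<alpha> + (\<alpha> / s)\<^sup>2 * \<beta>"
    using s(1) by (simp add: field_simps power2_eq_square)
  also have "\<dots> \<le> 0" by (rule assms)
  finally show ?thesis
    using s by (simp add: divide_le_0_iff mult_le_0_iff)
qed

text \<open>A zero of the form is a minimum, so the first-order change in every direction vanishes;
  in direction \<open>T x\<close> that change is twice the squared norm of
  \<open>T x\<close>.\<close>

lemma psd_form_eq_0:
  fixes T :: "'v::real_inner \<Rightarrow> 'v"
  assumes T: "linear T" and sym: "\<And>x y. T x \<bullet> y = x \<bullet> T y" and psd: "\<And>x. x \<bullet> T x \<ge> 0"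
    and "x \<bullet> T x = 0"
  shows "T x = 0"
proof -
  have "- 2 * (norm (T x))\<^sup>2 = 0"
  proof (rule linear_coefficient_eq_0)
    fix t
    have "(x + t *\<^sub>R T x) \<bullet> T (x + t *\<^sub>R T x)
        = x \<bullet> T x + 2 * t * (T x \<bullet> T x) + t\<^sup>2 * (T x \<bullet> T (T x))"
      by (simp add: linear_add[OF T] linear_scale[OF T] inner_add_left inner_add_right
          sym power2_eq_square algebra_simps)
    with psd[of "x + t *\<^sub>R T x"] \<open>x \<bullet> T x = 0\<close>
    show "t * (- 2 * (norm (T x))\<^sup>2) + t\<^sup>2 * - (T x \<bullet> T (T x)) \<le> 0"
      by (simp add: power2_norm_eq_inner)
  qed
  then show ?thesis by simp
qed

lemma converges_exponentially_bounded:
  assumes "converges_exponentially \<phi> z"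
  shows "bounded (\<phi> ` {0..})"
proof -
  obtain c \<mu> where c: "c \<ge> 0" "\<mu> > 0" "\<And>t. t \<ge> 0 \<Longrightarrow> dist (\<phi> t) z \<le> c * exp (- \<mu> * t)"
    using assms unfolding converges_exponentially_def by blast
  have "dist z (\<phi> t) \<le> c" if "t \<ge> 0" for t
  proof -
    have "c * exp (- \<mu> * t) \<le> c * 1" using c that by (intro mult_left_mono) auto
    with c(3)[OF that] show ?thesis by (simp add: dist_commute)
  qed
  then show ?thesis unfolding bounded_def by blast
qed

text \<open>\<open>g\<close> is an inner product adapted to \<open>M\<close>. Together with
  boundedness, \<open>g_ge_norm\<close> makes its norm equivalent to the given one, so stability and
  decay can be measured in either.\<close>

locale dissipative =
  fixes M :: "'s::euclidean_space \<Rightarrow> 's" and g :: "'s \<Rightarrow> 's \<Rightarrow> real"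
  assumes linear_M: "linear M"
    and bilinear_g: "bounded_bilinear g"
    and g_sym: "g x y = g y x"
    and g_ge_norm: "(norm x)\<^sup>2 \<le> g x x"
    and dissipative: "g x (M x) \<le> 0"
begin

lemmas g_simps =
  bounded_bilinear.add_left[OF bilinear_g] bounded_bilinear.diff_right[OF bilinear_g]
  bounded_bilinear.scaleR_left[OF bilinear_g] bounded_bilinear.scaleR_right[OF bilinear_g]
  bounded_bilinear.zero_left[OF bilinear_g]

lemma g_eq_0: "g x x = 0 \<Longrightarrow> x = 0"
  using g_ge_norm[of x] by simp

text \<open>Dissipativity at \<open>k + t *\<^sub>R v\<close> bounds a quadratic in \<open>t\<close>
  without constant term; its linear coefficient is \<open>g k (M v)\<close>.\<close>

lemma kernel_orthogonal_range:
  assumes k: "M k = 0"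
  shows "g k (M v) = 0"
proof (rule linear_coefficient_eq_0)
  fix t
  show "t * g k (M v) + t\<^sup>2 * g v (M v) \<le> 0"
    using dissipative[of "k + t *\<^sub>R v"] k
    by (simp add: linear_add[OF linear_M] linear_scale[OF linear_M] g_simps
        power2_eq_square distrib_left mult.assoc)
qed

text \<open>The difference of two range vectors with equal images lies in both kernel and range,
  hence is \<open>g\<close>-orthogonal to itself.\<close>

lemma inj_on_range: "inj_on M (range M)"
proof (rule inj_onI)
  fix x y assume "x \<in> range M" "y \<in> range M" and eq: "M x = M y"
  then obtain u v where "x = M u" "y = M v" by blast
  then have r: "x - y = M (u - v)" by (simp add: linear_diff[OF linear_M])
  have "M (x - y) = 0" using eq by (simp add: linear_diff[OF linear_M])
  from kernel_orthogonal_range[OF this, of "u - v"] have "x - y = 0"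
    by (intro g_eq_0) (simp add: r)
  then show "x = y" by simp
qed

text \<open>Injectivity on the range and equality of dimensions give that \<open>M\<close> maps its
  range onto itself, so \<open>M z\<close> already is the image of some \<open>M v\<close>.\<close>

lemma kernel_range_decomposition:
  obtains v where "M (z - M v) = 0"
proof -
  have sub: "subspace (range M)"
    by (simp add: linear_subspace_image[OF linear_M])
  have "dim (M ` range M) = dim (range M)"
    using inj_on_range by (intro dim_image_eq[OF linear_M]) (simp add: span_eq_iff[THEN iffD2, OF sub])
  then have "M ` range M = range M"
    by (intro subspace_dim_equal linear_subspace_image[OF linear_M] sub) auto
  then have "M z \<in> M ` range M" by simp
  then obtain v where "M z = M (M v)" by blast
  then show ?thesis using that[of v] by (simp add: linear_diff[OF linear_M])
qed

text \<open>The kernel component of \<open>b\<close> is orthogonal to \<open>b\<close> by assumption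
  and to the range component, hence to itself.\<close>

lemma range_eq_kernel_orthogonal:
  assumes "\<And>k. M k = 0 \<Longrightarrow> g k b = 0"
  shows "b \<in> range M"
proof -
  obtain v where v: "M (b - M v) = 0" by (rule kernel_range_decomposition)
  then have "g (b - M v) (b - M v) = 0"
    using assms[OF v] kernel_orthogonal_range[OF v] by (simp add: g_simps)
  then have "b - M v = 0" by (rule g_eq_0)
  then show ?thesis by auto
qed

section \<open>Quadratic Lyapunov functions along trajectories\<close>

lemma has_vector_derivative_form:
  fixes h :: "'s \<Rightarrow> 's \<Rightarrow> real"
  assumes "bounded_bilinear h" "solution M \<phi>" "t \<ge> 0"
  shows "((\<lambda>t. h (\<phi> t) (\<phi> t)) has_vector_derivative
    h (\<phi> t) (M (\<phi> t)) + h (M (\<phi> t)) (\<phi> t)) (at t within {0..})"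
  using assms bounded_bilinear.has_vector_derivative[OF assms(1)] by (simp add: solution_def)

lemma g_nonincreasing:
  assumes "solution M \<phi>" "t \<ge> 0"
  shows "g (\<phi> t) (\<phi> t) \<le> g (\<phi> 0) (\<phi> 0)"
  using assms dissipative
  by (intro nonincreasing_solution[OF has_vector_derivative_form[OF bilinear_g]])
    (auto simp: g_sym[of "M _"])

text \<open>Pairing with a kernel vector is a conserved quantity, because velocities lie in the
  range; it starts at zero and therefore stays zero.\<close>

lemma solution_in_range:
  assumes sol: "solution M \<phi>" and "\<phi> 0 \<in> range M" "t \<ge> 0"
  shows "\<phi> t \<in> range M"
proof (rule range_eq_kernel_orthogonal)
  fix k assume k: "M k = 0"
  have der: "((\<lambda>t. g k (\<phi> t)) has_vector_derivative 0) (at t within {0..})" if "t \<ge> 0" for t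
    using bounded_linear.has_vector_derivative
        [OF bounded_bilinear.bounded_linear_right[OF bilinear_g], of \<phi> "M (\<phi> t)" _ k]
      kernel_orthogonal_range[OF k] sol that
    by (simp add: solution_def)
  have "g k (\<phi> t) = g k (\<phi> 0)"
    using nonincreasing_solution[of "\<lambda>t. g k (\<phi> t)" "\<lambda>_. 0", OF der _ \<open>t \<ge> 0\<close>]
      nonincreasing_solution[of "\<lambda>t. - g k (\<phi> t)" "\<lambda>_. 0", OF _ _ \<open>t \<ge> 0\<close>]
      has_vector_derivative_minus[OF der]
    by simp
  also have "\<dots> = 0" using assms(2) kernel_orthogonal_range[OF k] by auto
  finally show "g k (\<phi> t) = 0" .
qed

text \<open>The form \<open>g\<close> alone decreases only weakly. Adding \<open>u\<close> to a
  large multiple of \<open>g\<close> repairs the directions without dissipation and yields a strict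
  Lyapunov function on the range; the kernel component of the initial value is the limit.\<close>

lemma exponentially_convergent:
  fixes u :: "'s \<Rightarrow> 's \<Rightarrow> real"
  assumes u: "bounded_bilinear u"
    and strict: "\<And>z. z \<in> range M \<Longrightarrow> z \<noteq> 0 \<Longrightarrow> g z (M z) = 0 \<Longrightarrow> u z (M z) + u (M z) z < 0"
    and sol: "solution M \<phi>"
  obtains k where "M k = 0" "converges_exponentially \<phi> k"
proof -
  note scale = linear_scale[OF linear_M] g_simps bounded_bilinear.scaleR_left[OF u] bounded_bilinear.scaleR_right[OF u]
  define p where "p = (\<lambda>z. - g z (M z))"
  define q where "q = (\<lambda>z. - (u z (M z) + u (M z) z))"
  have blM: "bounded_linear M" using linear_M by (simp add: linear_conv_bounded_linear)
  have contM: "continuous_on S M" for S using blM by (simp add: linear_continuous_on)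
  have cont: "continuous_on S p" "continuous_on S q" for S
    unfolding p_def q_def by (intro continuous_intros contM bounded_bilinear.continuous_on[OF bilinear_g]
        bounded_bilinear.continuous_on[OF u])+
  have closed: "closed (range M)"
    by (simp add: closed_subspace linear_subspace_image[OF linear_M])
  obtain \<kappa> c where c: "c > 0" and "\<kappa> \<ge> 0"
    and \<kappa>: "\<And>z. z \<in> sphere 0 1 \<inter> range M \<Longrightarrow> \<kappa> * p z + q z \<ge> c"
  proof (rule finsler_compact[of "sphere 0 1 \<inter> range M" p q])
    show "compact (sphere 0 1 \<inter> range M)" by (simp add: closed compact_Int_closed)
    show "p z \<ge> 0" for z using dissipative by (simp add: p_def)
    show "q z > 0" if "z \<in> sphere 0 1 \<inter> range M" "p z = 0" for z
      proof -
      from that have "z \<in> range M" "z \<noteq> 0" "g z (M z) = 0" by (auto simp: p_def)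
      from strict[OF this] show ?thesis by (simp add: q_def)
    qed
  qed (auto intro: cont)
  obtain Ku where Ku: "Ku > 0" "\<And>x y. norm (u x y) \<le> norm x * norm y * Ku"
    using bounded_bilinear.pos_bounded[OF u] by blast
  obtain Kg where Kg: "Kg > 0" "\<And>x y. norm (g x y) \<le> norm x * norm y * Kg"
    using bounded_bilinear.pos_bounded[OF bilinear_g] by blast
  \<comment> \<open>The summand \<open>\<kappa>\<close> secures the decrease; \<open>Ku + 1\<close>
    absorbs the possibly negative \<open>u\<close>, so that \<open>W\<close> still dominates the
    squared norm.\<close>
  define \<kappa>' where "\<kappa>' = \<kappa> + Ku + 1"
  define C where "C = \<kappa>' * Kg + Ku"
  have \<kappa>': "\<kappa>' \<ge> 0" using \<open>\<kappa> \<ge> 0\<close> Ku(1) by (simp add: \<kappa>'_def)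
  have C: "C > 0" using \<open>\<kappa> \<ge> 0\<close> Ku(1) Kg(1) by (simp add: C_def \<kappa>'_def add_nonneg_pos)
  define W where "W = (\<lambda>z. \<kappa>' * g z z + u z z)"
  have uu: "\<bar>u z z\<bar> \<le> Ku * (norm z)\<^sup>2" for z
    using Ku(2)[of z z] by (simp add: power2_eq_square mult.commute)
  have W_lower: "(norm z)\<^sup>2 \<le> W z" for z
  proof -
    have "(Ku + 1) * (norm z)\<^sup>2 \<le> \<kappa>' * g z z"
      using g_ge_norm[of z] \<open>\<kappa> \<ge> 0\<close> Ku(1) by (intro mult_mono) (auto simp: \<kappa>'_def)
    then show ?thesis using uu[of z] by (simp add: W_def distrib_right abs_le_iff)
  qed
  have W_upper: "W z \<le> C * (norm z)\<^sup>2" for z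
  proof -
    have "\<kappa>' * g z z \<le> \<kappa>' * (Kg * (norm z)\<^sup>2)"
      using Kg(2)[of z z] \<kappa>' by (intro mult_left_mono) (auto simp: power2_eq_square mult.commute)
    then show ?thesis using uu[of z] by (simp add: W_def C_def algebra_simps abs_le_iff)
  qed
  define W' where "W' = (\<lambda>z. 2 * \<kappa>' * g z (M z) + (u z (M z) + u (M z) z))"
  have W'_le: "W' z \<le> - (c / C) * W z" if "z \<in> range M" for z
  proof (cases "z = 0")
    case True
    then show ?thesis by (simp add: W_def W'_def g_simps bounded_bilinear.zero_left[OF u]
          linear_0[OF linear_M])
  next
    case False
    \<comment> \<open>All forms are homogeneous of degree two, so the bound on the unit sphere
      scales to every nonzero \<open>z\<close>.\<close>
    define e where "e = z /\<^sub>R norm z"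
    have "e \<in> range M"
      using that by (auto simp: e_def linear_scale[OF linear_M, symmetric])
    then have "c \<le> \<kappa> * p e + q e" using False by (intro \<kappa>) (simp add: e_def)
    also have "\<dots> = (\<kappa> * p z + q z) / (norm z)\<^sup>2"
      by (simp add: e_def p_def q_def scale divide_inverse power2_eq_square algebra_simps)
    finally have "c * (norm z)\<^sup>2 \<le> \<kappa> * p z + q z"
      using False by (simp add: field_simps)
    moreover have "\<kappa> * p z \<le> 2 * \<kappa>' * p z"
      using dissipative[of z] \<open>\<kappa> \<ge> 0\<close> Ku(1) by (intro mult_right_mono) (auto simp: \<kappa>'_def p_def)
    ultimately have "W' z \<le> - c * (norm z)\<^sup>2"
      by (simp add: W'_def p_def q_def)
    also have "\<dots> \<le> - (c / C) * W z"
      using mult_left_mono[OF W_upper[of z], of "c / C"] c C by (simp add: field_simps)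
    finally show ?thesis .
  qed
  \<comment> \<open>Subtracting the kernel component \<open>k\<close> leaves a solution of the same
    linear equation that starts, and hence stays, in the range.\<close>
  obtain v where v: "M (\<phi> 0 - M v) = 0" by (rule kernel_range_decomposition)
  define k where "k = \<phi> 0 - M v"
  define \<psi> where "\<psi> = (\<lambda>t. \<phi> t - k)"
  have Mk: "M k = 0" using v by (simp add: k_def)
  have sol\<psi>: "solution M \<psi>"
    using sol unfolding solution_def \<psi>_def
    by (auto intro!: derivative_eq_intros simp: linear_diff[OF linear_M] Mk)
  have \<psi>_range: "\<psi> t \<in> range M" if "t \<ge> 0" for t
    by (rule solution_in_range[OF sol\<psi> _ that]) (simp add: \<psi>_def k_def)
  have decay: "W (\<psi> t) \<le> W (\<psi> 0) * exp (- (c / C) * t)" if "t \<ge> 0" for t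
  proof (rule exponential_decay[OF _ _ that])
    fix s :: real assume s: "s \<ge> 0"
    show "((\<lambda>t. W (\<psi> t)) has_vector_derivative W' (\<psi> s)) (at s within {0..})"
      unfolding W_def W'_def
      by (rule has_vector_derivative_eq_rhs,
          rule has_vector_derivative_add
            [OF has_vector_derivative_mult_right[OF has_vector_derivative_form[OF bilinear_g sol\<psi> s]]
              has_vector_derivative_form[OF u sol\<psi> s]])
        (simp add: g_sym[of "M _"])
    show "W' (\<psi> s) \<le> - (c / C) * W (\<psi> s)" by (rule W'_le[OF \<psi>_range[OF s]])
  qed
  have W0: "W (\<psi> 0) \<ge> 0"
    using W_lower[of "\<psi> 0"] zero_le_power2[of "norm (\<psi> 0)"] by linarith
  \<comment> \<open>\<open>W\<close> controls the squared norm, so taking the square root halves the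
    rate.\<close>
  have "dist (\<phi> t) k \<le> sqrt (W (\<psi> 0)) * exp (- (c / (2 * C)) * t)" if "t \<ge> 0" for t
  proof -
    have "(norm (\<psi> t))\<^sup>2 \<le> W (\<psi> 0) * exp (- (c / C) * t)"
      using W_lower decay[OF that] by (rule order_trans)
    also have "\<dots> = (sqrt (W (\<psi> 0)) * exp (- (c / (2 * C)) * t))\<^sup>2"
      using W0 by (simp add: power_mult_distrib exp_double[symmetric])
    finally have "norm (\<psi> t) \<le> sqrt (W (\<psi> 0)) * exp (- (c / (2 * C)) * t)"
      by (rule power2_le_imp_le) (simp add: W0)
    then show ?thesis by (simp add: dist_norm \<psi>_def)
  qed
  then have "converges_exponentially \<phi> k"
    unfolding converges_exponentially_def using c C W0
    by (intro exI[of _ "sqrt (W (\<psi> 0))"] conjI exI[of _ "c / (2 * C)"]) auto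
  with Mk show ?thesis by (rule that)
qed

section \<open>Affine flows reduced to linear ones\<close>

lemma solution_shift:
  assumes "equilibrium (\<lambda>v. M v + b) e" "solution (\<lambda>v. M v + b) \<phi>"
  shows "solution M (\<lambda>t. \<phi> t - e)"
proof -
  have "M v + b = M (v - e)" for v
    using assms(1) by (simp add: equilibrium_def linear_diff[OF linear_M] add_eq_0_iff)
  with assms(2) show ?thesis
    unfolding solution_def by (auto intro!: derivative_eq_intros)
qed

lemma equilibrium_lyapunov_stable:
  assumes e: "equilibrium (\<lambda>v. M v + b) e"
  shows "lyapunov_stable (\<lambda>v. M v + b) e"
  unfolding lyapunov_stable_def
proof (intro allI impI)
  fix \<epsilon> :: real assume "\<epsilon> > 0"
  obtain K where K: "K > 0" "\<And>x y. norm (g x y) \<le> norm x * norm y * K"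
    using bounded_bilinear.pos_bounded[OF bilinear_g] by blast
  show "\<exists>\<delta>>0. \<forall>\<phi>. solution (\<lambda>v. M v + b) \<phi> \<and> \<phi> 0 \<in> ball e \<delta> \<longrightarrow> (\<forall>t\<ge>0. \<phi> t \<in> ball e \<epsilon>)"
  \<comment> \<open>The radius comes from \<open>g x x\<close> lying between the squared norm and
    \<open>K\<close> times it, with \<open>g\<close> nonincreasing along the shifted
    solution.\<close>
  proof (intro exI[of _ "\<epsilon> / sqrt K"] conjI allI impI)
    show "\<epsilon> / sqrt K > 0" using \<open>\<epsilon> > 0\<close> K(1) by simp
    fix \<phi> and t :: real
    assume \<phi>: "solution (\<lambda>v. M v + b) \<phi> \<and> \<phi> 0 \<in> ball e (\<epsilon> / sqrt K)" and "t \<ge> 0"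
    have "(norm (\<phi> t - e))\<^sup>2 \<le> g (\<phi> t - e) (\<phi> t - e)" by (rule g_ge_norm)
    also have "\<dots> \<le> g (\<phi> 0 - e) (\<phi> 0 - e)"
      using g_nonincreasing[OF solution_shift[OF e]] \<phi> \<open>t \<ge> 0\<close> by simp
    also have "\<dots> \<le> (sqrt K * norm (\<phi> 0 - e))\<^sup>2"
      using K(2)[of "\<phi> 0 - e" "\<phi> 0 - e"] K(1)
      by (simp add: power_mult_distrib power2_eq_square[of "norm _"] mult_ac)
    finally have "norm (\<phi> t - e) \<le> sqrt K * norm (\<phi> 0 - e)"
      by (rule power2_le_imp_le) (use K(1) in simp)
    also have "\<dots> < \<epsilon>"
      using \<phi> K(1) by (simp add: dist_norm norm_minus_commute field_simps)
    finally show "\<phi> t \<in> ball e \<epsilon>" by (simp add: dist_norm norm_minus_commute)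
  qed
qed

text \<open>If \<open>b = M v\<close>, then \<open>- v\<close> is an equilibrium. The shifted
  trajectory tends to some kernel vector \<open>k\<close>, and \<open>k - v\<close> is again an
  equilibrium.\<close>

lemma affine_exponentially_convergent:
  fixes u :: "'s \<Rightarrow> 's \<Rightarrow> real"
  assumes "bounded_bilinear u"
    and "\<And>z. z \<in> range M \<Longrightarrow> z \<noteq> 0 \<Longrightarrow> g z (M z) = 0 \<Longrightarrow> u z (M z) + u (M z) z < 0"
    and "b \<in> range M" and sol: "solution (\<lambda>v. M v + b) \<phi>"
  obtains e where "equilibrium (\<lambda>v. M v + b) e" "converges_exponentially \<phi> e"
proof -
  obtain v where v: "b = M v" using assms(3) by blast
  have "equilibrium (\<lambda>v. M v + b) (- v)"
    by (simp add: equilibrium_def v linear_neg[OF linear_M])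
  then obtain k where k: "M k = 0" "converges_exponentially (\<lambda>t. \<phi> t - (- v)) k"
    using exponentially_convergent[OF assms(1,2) solution_shift[OF _ sol]] by blast
  show ?thesis
  proof
    show "equilibrium (\<lambda>v. M v + b) (k - v)"
      using k(1) by (simp add: equilibrium_def v linear_diff[OF linear_M])
    show "converges_exponentially \<phi> (k - v)"
      using k(2) by (simp add: converges_exponentially_def dist_norm algebra_simps)
  qed
qed

end

section \<open>Saddle-point flows with derivative feedback\<close>

text \<open>The underlying problem minimises half of \<open>y \<bullet> P y\<close> minus
  \<open>y \<bullet> h\<close> subject to \<open>\<alpha> *\<^sub>R y - C x + L z = 0\<close> and
  \<open>L y = 0\<close>. The assumption \<open>h_orthogonal\<close> is what puts the inhomogeneity
  into the range of the flow.\<close>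

locale saddle_flow =
  fixes L P :: "'w::euclidean_space \<Rightarrow> 'w" and C :: "'x::euclidean_space \<Rightarrow> 'w"
    and Ct :: "'w \<Rightarrow> 'x" and \<alpha> :: real and h :: 'w
  assumes linear_L: "linear L" and linear_P: "linear P" and linear_C: "linear C"
    and linear_Ct: "linear Ct"
    and L_sym: "L x \<bullet> y = x \<bullet> L y" and L_psd: "x \<bullet> L x \<ge> 0"
    and P_sym: "P x \<bullet> y = x \<bullet> P y" and P_psd: "x \<bullet> P x \<ge> 0"
    and adjoint: "C v \<bullet> y = v \<bullet> Ct y"
    and \<alpha>_pos: "\<alpha> > 0"
    and h_orthogonal: "P y = 0 \<Longrightarrow> y \<bullet> h = 0"
begin

lemmas linear_simps =
  linear_add[OF linear_L] linear_add[OF linear_P] linear_add[OF linear_C] linear_add[OF linear_Ct]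
  linear_diff[OF linear_L] linear_diff[OF linear_P] linear_diff[OF linear_C] linear_diff[OF linear_Ct]
  linear_scale[OF linear_L] linear_scale[OF linear_P] linear_scale[OF linear_C] linear_scale[OF linear_Ct]
  linear_neg[OF linear_L] linear_neg[OF linear_P] linear_neg[OF linear_C] linear_neg[OF linear_Ct]
  linear_0[OF linear_L] linear_0[OF linear_P] linear_0[OF linear_C] linear_0[OF linear_Ct]

text \<open>The homogeneous part of the Y-velocity: minus the gradient in \<open>y\<close> of the
  Lagrangian augmented by half of \<open>y \<bullet> L y\<close>, without \<open>h\<close>.\<close>

definition primal :: "'w \<Rightarrow> 'w \<Rightarrow> 'w \<Rightarrow> 'w" where
  "primal y l m = - P y - L y - \<alpha> *\<^sub>R l - L m"

definition flow :: "'x \<times> 'w \<times> 'w \<times> 'w \<times> 'w \<Rightarrow> 'x \<times> 'w \<times> 'w \<times> 'w \<times> 'w" where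
  "flow = (\<lambda>(x, y, z, l, m).
    (Ct l, primal y l m, - L l,
     \<alpha> *\<^sub>R (y + primal y l m) - C (x + Ct l) + L z - L l, L (y + primal y l m)))"

text \<open>The inhomogeneity \<open>h\<close> of \<open>dY\<close> reappears through the feedback of \<open>dY\<close> into the multiplier
  equations.\<close>

definition offset :: "'x \<times> 'w \<times> 'w \<times> 'w \<times> 'w" where
  "offset = (0, h, 0, \<alpha> *\<^sub>R h, L h)"

text \<open>The Gram operator of the adapted inner product. The extra \<open>P + L\<close> is the
  Hessian of the augmented objective and cancels the mixed terms which the feedback of the
  Y-velocity creates.\<close>

definition weight :: "'x \<times> 'w \<times> 'w \<times> 'w \<times> 'w \<Rightarrow> 'x \<times> 'w \<times> 'w \<times> 'w \<times> 'w" where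
  "weight = (\<lambda>(x, y, z, l, m). (x, y + P y + L y, z, l, m))"

text \<open>The auxiliary form \<open>u\<close>: it pairs the velocity of the first multiplier with
  that of \<open>y\<close>, and so sees motion of that multiplier alone, which the energy
  misses.\<close>

definition cross :: "'x \<times> 'w \<times> 'w \<times> 'w \<times> 'w \<Rightarrow> 'x \<times> 'w \<times> 'w \<times> 'w \<times> 'w \<Rightarrow> real" where
  "cross v w = fst (snd (snd (snd (flow v)))) \<bullet> fst (snd (flow w))"

lemma linear_flow: "linear flow"
  by (rule linearI) (auto simp: flow_def primal_def linear_simps algebra_simps)

lemma linear_weight: "linear weight"
  by (rule linearI) (auto simp: weight_def linear_simps algebra_simps)

lemma energy_dissipation:
  "(x, y, z, l, m) \<bullet> weight (flow (x, y, z, l, m))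
    = - (y \<bullet> P y) - y \<bullet> L y - (norm (Ct l))\<^sup>2 - (norm (primal y l m))\<^sup>2 - l \<bullet> L l"
proof -
  define d where "d = primal y l m"
  \<comment> \<open>Solving the Y-equation for the multiplier terms turns the feedback pairing into
    \<open>- d \<bullet> d\<close> plus terms that the weighted Y-pairing cancels, up to the two
    semidefinite forms in \<open>y\<close>.\<close>
  have d: "\<alpha> *\<^sub>R l + L m = - d - P y - L y"
    by (simp add: d_def primal_def)
  have "l \<bullet> (\<alpha> *\<^sub>R (y + d)) + m \<bullet> L (y + d) = (\<alpha> *\<^sub>R l + L m) \<bullet> (y + d)"
    by (simp add: inner_add_left L_sym)
  also have "\<dots> = - (d \<bullet> y) - d \<bullet> d - P y \<bullet> y - P y \<bullet> d - L y \<bullet> y - L y \<bullet> d"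
    unfolding d by (simp add: inner_add_right inner_diff_left)
  finally have *: "l \<bullet> (\<alpha> *\<^sub>R (y + d)) + m \<bullet> L (y + d)
      = - (d \<bullet> y) - d \<bullet> d - P y \<bullet> y - P y \<bullet> d - L y \<bullet> y - L y \<bullet> d" .
  have **: "l \<bullet> C v = v \<bullet> Ct l" for v
    by (metis adjoint inner_commute)
  have "(x, y, z, l, m) \<bullet> weight (flow (x, y, z, l, m))
      = x \<bullet> Ct l + (y \<bullet> d + y \<bullet> P d + y \<bullet> L d) - z \<bullet> L l
        + (l \<bullet> (\<alpha> *\<^sub>R (y + d)) + m \<bullet> L (y + d)) - (x + Ct l) \<bullet> Ct l + l \<bullet> L z - l \<bullet> L l"
    by (simp add: flow_def weight_def d_def[symmetric] inner_diff_right ** inner_add_right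
        del: inner_scaleR_right)
  also have "y \<bullet> P d = P y \<bullet> d" by (simp add: P_sym)
  also have "y \<bullet> L d = L y \<bullet> d" by (simp add: L_sym)
  also have "l \<bullet> L z = z \<bullet> L l" by (metis L_sym inner_commute)
  finally show ?thesis
    unfolding * d_def[symmetric]
    by (simp add: inner_add_left inner_add_right power2_norm_eq_inner inner_commute)
qed

text \<open>The dissipation is a sum of five nonpositive terms, so each vanishes, and a zero of a
  semidefinite form lies in the kernel.\<close>

lemma stationary:
  assumes "(x, y, z, l, m) \<bullet> weight (flow (x, y, z, l, m)) = 0"
  shows "P y = 0" "L y = 0" "Ct l = 0" "primal y l m = 0" "L l = 0"
proof -
  have "y \<bullet> P y = 0 \<and> y \<bullet> L y = 0 \<and> (norm (Ct l))\<^sup>2 = 0 \<and> (norm (primal y l m))\<^sup>2 = 0 \<and> l \<bullet> L l = 0"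
    using assms P_psd[of y] L_psd[of y] L_psd[of l] zero_le_power2[of "norm (Ct l)"]
      zero_le_power2[of "norm (primal y l m)"]
    unfolding energy_dissipation by linarith
  then show "P y = 0" "L y = 0" "Ct l = 0" "primal y l m = 0" "L l = 0"
    using psd_form_eq_0[OF linear_L L_sym L_psd] psd_form_eq_0[OF linear_P P_sym P_psd] by auto
qed

lemma dissipative_flow: "dissipative flow (\<lambda>v w. v \<bullet> weight w)"
proof (rule dissipative.intro)
  show "bounded_bilinear (\<lambda>v w. v \<bullet> weight w)"
    by (rule bounded_bilinear.comp[OF bounded_bilinear_inner bounded_linear_ident
          linear_conv_bounded_linear[THEN iffD1, OF linear_weight]])
  show "v \<bullet> weight w = w \<bullet> weight v" for v w
  proof (cases v; cases w)
    fix x y z l m x' y' z' l' m'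
    assume [simp]: "v = (x, y, z, l, m)" "w = (x', y', z', l', m')"
    have "y \<bullet> P y' = y' \<bullet> P y" "y \<bullet> L y' = y' \<bullet> L y"
      by (metis P_sym inner_commute, metis L_sym inner_commute)
    then show ?thesis
      by (simp add: weight_def inner_add_right inner_commute[of x'] inner_commute[of y' y]
          inner_commute[of z'] inner_commute[of l'] inner_commute[of m'])
  qed
  show "(norm v)\<^sup>2 \<le> v \<bullet> weight v" for v
    using P_psd L_psd by (cases v) (simp add: weight_def inner_add_right power2_norm_eq_inner)
  show "v \<bullet> weight (flow v) \<le> 0" for v
  proof (cases v)
    case (fields x y z l m)
    show ?thesis
      unfolding fields energy_dissipation using P_psd[of y] L_psd[of y] L_psd[of l]
        zero_le_power2[of "norm (Ct l)"] zero_le_power2[of "norm (primal y l m)"] by linarith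
  qed
qed (rule linear_flow)

lemma bounded_bilinear_cross: "bounded_bilinear cross"
proof -
  have "bounded_linear flow" using linear_flow by (simp add: linear_conv_bounded_linear)
  then show ?thesis
    unfolding cross_def[abs_def]
    by (intro bounded_bilinear.comp[OF bounded_bilinear_inner] bounded_linear_fst_comp
        bounded_linear_snd_comp)
qed

lemma cross_strict:
  assumes "v \<in> range flow" "v \<noteq> 0" "v \<bullet> weight (flow v) = 0"
  shows "cross v (flow v) + cross (flow v) v < 0"
proof (cases v)
  case (fields x y z l m)
  note stat = stationary[OF assms(3)[unfolded fields]]
  define r where "r = fst (snd (snd (snd (flow v))))"
  have w: "flow v = (0, 0, 0, r, 0)"
    by (simp add: r_def flow_def fields stat linear_simps)
  \<comment> \<open>The flow is injective on its range, which contains both \<open>v\<close> and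
    \<open>0\<close>.\<close>
  have "flow v \<noteq> 0"
  proof
    assume "flow v = 0"
    then have "flow v = flow 0" by (simp add: linear_0[OF linear_flow])
    moreover have "0 \<in> range flow" by (metis linear_0[OF linear_flow] rangeI)
    ultimately show False using assms(1,2) dissipative.inj_on_range[OF dissipative_flow] by (auto dest: inj_onD)
  qed
  then have "r \<noteq> 0" by (auto simp: w zero_prod_def)
  \<comment> \<open>Applied to \<open>(0, 0, 0, r, 0)\<close> the flow has Y-component
    \<open>- \<alpha> *\<^sub>R r\<close>, so the first term is
    \<open>- \<alpha> * (r \<bullet> r)\<close>; the second vanishes with the Y-component of
    \<open>flow v\<close>.\<close>
  then show ?thesis
    using \<alpha>_pos unfolding cross_def w by (simp add: flow_def primal_def linear_simps)
qed

lemma offset_in_range: "offset \<in> range flow"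
proof (rule dissipative.range_eq_kernel_orthogonal[OF dissipative_flow])
  fix k assume k: "flow k = 0"
  show "k \<bullet> weight offset = 0"
  proof (cases k)
    case (fields x y z l m)
    \<comment> \<open>A kernel vector is stationary, so its multiplier terms cancel and its
      Y-component lies in the kernel of \<open>P\<close>, to which \<open>h\<close> is
      orthogonal.\<close>
    have "k \<bullet> weight (flow k) = 0" unfolding k by (simp add: linear_0[OF linear_weight])
    note stat = stationary[OF this[unfolded fields]]
    have "\<alpha> *\<^sub>R l + L m = 0"
      using stat by (simp add: primal_def add_eq_0_iff)
    moreover have "k \<bullet> weight offset = y \<bullet> h + P y \<bullet> h + L y \<bullet> h + (\<alpha> *\<^sub>R l + L m) \<bullet> h"
      by (simp add: fields weight_def offset_def inner_add_right inner_add_left P_sym L_sym)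
    ultimately show ?thesis using stat h_orthogonal by simp
  qed
qed

lemma flow_stable:
  "equilibrium (\<lambda>v. flow v + offset) e \<Longrightarrow> lyapunov_stable (\<lambda>v. flow v + offset) e"
  by (rule dissipative.equilibrium_lyapunov_stable[OF dissipative_flow])

lemma flow_convergent:
  assumes "solution (\<lambda>v. flow v + offset) \<phi>"
  obtains e where "equilibrium (\<lambda>v. flow v + offset) e" "converges_exponentially \<phi> e"
  by (rule dissipative.affine_exponentially_convergent[OF dissipative_flow bounded_bilinear_cross
        cross_strict offset_in_range assms])

lemma equilibrium_conditions:
  assumes "equilibrium (\<lambda>v. flow v + offset) (x, y, z, l, m)"
  shows "Ct l = 0" "L l = 0" "L y = 0" "\<alpha> *\<^sub>R y - C x + L z = 0" "P y - h + \<alpha> *\<^sub>R l + L m = 0"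
proof -
  \<comment> \<open>The full Y-velocity. Both multiplier equations contain \<open>y + d\<close>, so
    at an equilibrium the feedback drops out and the optimality conditions remain.\<close>
  define d where "d = primal y l m + h"
  have *: "Ct l = 0" "d = 0" "L l = 0"
    "\<alpha> *\<^sub>R (y + d) - C (x + Ct l) + L z - L l = 0" "L (y + d) = 0"
  proof -
    have eqs: "Ct l = 0" "primal y l m + h = 0" "- L l = 0"
      "\<alpha> *\<^sub>R (y + primal y l m) - C (x + Ct l) + L z - L l + \<alpha> *\<^sub>R h = 0"
      "L (y + primal y l m) + L h = 0"
      using assms
      unfolding equilibrium_def flow_def offset_def zero_prod_def prod.case add_Pair
        prod.inject add_0_right by blast+
    have "\<alpha> *\<^sub>R (y + d) - C (x + Ct l) + L z - L l
        = \<alpha> *\<^sub>R (y + primal y l m) - C (x + Ct l) + L z - L l + \<alpha> *\<^sub>R h"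
      by (simp add: d_def scaleR_add_right)
    then show "\<alpha> *\<^sub>R (y + d) - C (x + Ct l) + L z - L l = 0"
      by (simp only: eqs(4))
    have "L (y + d) = L (y + primal y l m) + L h"
      by (simp add: d_def linear_simps)
    then show "L (y + d) = 0"
      by (simp only: eqs(5))
    show "Ct l = 0" "d = 0" "L l = 0"
      using eqs by (simp_all add: d_def)
  qed
  then show "Ct l = 0" "L l = 0" "L y = 0" "\<alpha> *\<^sub>R y - C x + L z = 0" by auto
  then show "P y - h + \<alpha> *\<^sub>R l + L m = 0"
    using * by (auto simp: d_def primal_def algebra_simps)
qed

end

section \<open>Least squares, graph Laplacians and blocks\<close>

lemma inner_matrix_matrix_left:
  fixes A :: "real^'r^'m" and X :: "real^'q^'r"
  shows "(A ** X) \<bullet> Y = X \<bullet> (transpose A ** Y)"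
proof -
  have "(A ** X) \<bullet> Y = (\<Sum>i\<in>UNIV. \<Sum>j\<in>UNIV. \<Sum>k\<in>UNIV. A $ i $ k * X $ k $ j * Y $ i $ j)"
    by (simp add: inner_vec_def matrix_matrix_mult_def sum_distrib_right)
  also have "\<dots> = (\<Sum>i\<in>UNIV. \<Sum>k\<in>UNIV. \<Sum>j\<in>UNIV. A $ i $ k * X $ k $ j * Y $ i $ j)"
    by (intro sum.cong refl sum.swap)
  also have "\<dots> = (\<Sum>k\<in>UNIV. \<Sum>i\<in>UNIV. \<Sum>j\<in>UNIV. A $ i $ k * X $ k $ j * Y $ i $ j)"
    by (rule sum.swap)
  also have "\<dots> = (\<Sum>k\<in>UNIV. \<Sum>j\<in>UNIV. \<Sum>i\<in>UNIV. A $ i $ k * X $ k $ j * Y $ i $ j)"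
    by (intro sum.cong refl sum.swap)
  also have "\<dots> = X \<bullet> (transpose A ** Y)"
    by (simp add: inner_vec_def matrix_matrix_mult_def transpose_def sum_distrib_left mult_ac)
  finally show ?thesis .
qed

lemma inner_matrix_matrix_right:
  fixes X :: "real^'p^'r" and B :: "real^'q^'p"
  shows "(X ** B) \<bullet> Y = X \<bullet> (Y ** transpose B)"
proof -
  have "(X ** B) \<bullet> Y = (\<Sum>i\<in>UNIV. \<Sum>j\<in>UNIV. \<Sum>k\<in>UNIV. X $ i $ k * B $ k $ j * Y $ i $ j)"
    by (simp add: inner_vec_def matrix_matrix_mult_def sum_distrib_right)
  also have "\<dots> = (\<Sum>i\<in>UNIV. \<Sum>k\<in>UNIV. \<Sum>j\<in>UNIV. X $ i $ k * B $ k $ j * Y $ i $ j)"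
    by (intro sum.cong refl sum.swap)
  also have "\<dots> = X \<bullet> (Y ** transpose B)"
    by (simp add: inner_vec_def matrix_matrix_mult_def transpose_def sum_distrib_left mult_ac)
  finally show ?thesis .
qed

lemma linear_matrix_matrix_right: "linear (\<lambda>X :: real^'q^'r. A ** X)" for A :: "real^'r^'m"
  by (rule linearI)
    (simp_all add: matrix_matrix_mult_def vec_eq_iff sum.distrib sum_distrib_left algebra_simps)

lemma linear_matrix_matrix_left: "linear (\<lambda>X :: real^'p^'r. X ** B)" for B :: "real^'q^'p"
  by (rule linearI)
    (simp_all add: matrix_matrix_mult_def vec_eq_iff sum.distrib sum_distrib_left algebra_simps)

text \<open>The normal equation makes the residual orthogonal to every
  \<open>A ** (X' - X) ** B\<close>, and Pythagoras gives minimality.\<close>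

lemma least_squares_of_normal_equation:
  assumes "transpose A ** (A ** X ** B - F) ** transpose B = 0"
  shows "least_squares_solution A B F X"
proof -
  have "(norm (A ** X ** B - F))\<^sup>2 \<le> (norm (A ** X' ** B - F))\<^sup>2" for X'
  proof -
    define R D where "R = A ** X ** B - F" and "D = A ** (X' - X) ** B"
    have "A ** X' ** B - F = R + D"
      by (simp add: R_def D_def linear_diff[OF linear_matrix_matrix_right]
          linear_diff[OF linear_matrix_matrix_left])
    moreover have "D \<bullet> R = 0"
    proof -
      have "D \<bullet> R = (A ** (X' - X)) \<bullet> (R ** transpose B)"
        unfolding D_def by (rule inner_matrix_matrix_right)
      also have "\<dots> = (X' - X) \<bullet> (transpose A ** R ** transpose B)"
        by (simp only: inner_matrix_matrix_left matrix_mul_assoc)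
      finally show ?thesis using assms by (simp add: R_def)
    qed
    ultimately have "(norm (A ** X' ** B - F))\<^sup>2 = (norm R)\<^sup>2 + (norm D)\<^sup>2"
      by (simp add: power2_norm_eq_inner inner_add_left inner_add_right inner_commute)
    then show ?thesis by (simp add: R_def)
  qed
  then show ?thesis
    by (auto simp: least_squares_solution_def is_arg_min_def not_less)
qed

section \<open>The weighted graph Laplacian and its kernel\<close>

definition laplacian :: "real^'n^'n \<Rightarrow> 'v::euclidean_space^'n \<Rightarrow> 'v^'n" where
  "laplacian a Y = (\<chi> i. disagreement a (($) Y) i)"

lemma laplacian_nth [simp]: "laplacian a Y $ i = disagreement a (($) Y) i"
  by (simp add: laplacian_def)

lemma linear_laplacian: "linear (laplacian a)"
  by (rule linearI)
    (simp_all add: laplacian_def vec_eq_iff disagreement_def sum.distrib[symmetric] scaleR_sum_right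
      algebra_simps)

context
  fixes a :: "real^'n^'n"
  assumes sym: "\<And>i j. a $ i $ j = a $ j $ i"
begin

text \<open>The polarised Dirichlet form: the pairing is added to its copy with \<open>i\<close> and
  \<open>j\<close> exchanged, which symmetry of the weights permits.\<close>

lemma laplacian_inner:
  "2 * (laplacian a Y \<bullet> W)
    = (\<Sum>i\<in>UNIV. \<Sum>j\<in>UNIV. a $ i $ j * ((Y $ i - Y $ j) \<bullet> (W $ i - W $ j)))"
proof -
  have 1: "laplacian a Y \<bullet> W = (\<Sum>i\<in>UNIV. \<Sum>j\<in>UNIV. a $ i $ j * ((Y $ i - Y $ j) \<bullet> W $ i))"
    by (simp add: inner_vec_def disagreement_def inner_sum_left)
  also have "\<dots> = (\<Sum>i\<in>UNIV. \<Sum>j\<in>UNIV. a $ i $ j * ((Y $ j - Y $ i) \<bullet> W $ j))"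
    by (subst sum.swap) (simp add: sym)
  finally have 2: "laplacian a Y \<bullet> W = (\<Sum>i\<in>UNIV. \<Sum>j\<in>UNIV. a $ i $ j * ((Y $ j - Y $ i) \<bullet> W $ j))" .
  have "2 * (laplacian a Y \<bullet> W) = laplacian a Y \<bullet> W + laplacian a Y \<bullet> W" by simp
  also have "\<dots> = (\<Sum>i\<in>UNIV. \<Sum>j\<in>UNIV. a $ i $ j * ((Y $ i - Y $ j) \<bullet> (W $ i - W $ j)))"
    by (subst 1, subst 2) (simp add: sum.distrib[symmetric] inner_diff_left inner_diff_right algebra_simps)
  finally show ?thesis .
qed

lemma laplacian_sym: "laplacian a Y \<bullet> W = Y \<bullet> laplacian a W"
  using laplacian_inner[of Y W] laplacian_inner[of W Y] by (simp add: inner_commute)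

text \<open>Constant families lie in the kernel, so by symmetry the image is orthogonal to all of
  them.\<close>

lemma sum_laplacian:
  fixes Y :: "'v::euclidean_space^'n"
  shows "(\<Sum>i\<in>UNIV. laplacian a Y $ i) = 0"
proof (rule vector_eq_rdot[THEN iffD1, rule_format])
  fix v :: 'v
  have "laplacian a (\<chi> i. v) = 0"
    by (simp add: vec_eq_iff disagreement_def)
  then have "laplacian a Y \<bullet> (\<chi> i. v) = 0"
    by (simp add: laplacian_sym)
  then show "(\<Sum>i\<in>UNIV. laplacian a Y $ i) \<bullet> v = 0 \<bullet> v"
    by (simp add: inner_vec_def inner_sum_left)
qed

lemma laplacian_psd:
  assumes "\<And>i j. a $ i $ j \<ge> 0"
  shows "Y \<bullet> laplacian a Y \<ge> 0"
proof -
  have "2 * (laplacian a Y \<bullet> Y) \<ge> 0"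
    unfolding laplacian_inner by (intro sum_nonneg mult_nonneg_nonneg assms inner_ge_zero)
  then show ?thesis by (simp add: inner_commute)
qed

end

lemma adjacency_matrix_sym: "adjacency_matrix E a \<Longrightarrow> a $ i $ j = a $ j $ i"
  by (simp add: adjacency_matrix_def)

lemma adjacency_matrix_nonneg: "adjacency_matrix E a \<Longrightarrow> a $ i $ j \<ge> 0"
  unfolding adjacency_matrix_def by (metis less_imp_le order_refl)

text \<open>Every term of the Dirichlet form is nonnegative and so vanishes; values agree across
  each edge, and then along paths.\<close>

lemma laplacian_kernel_consensus:
  assumes adj: "adjacency_matrix E a" and "connected_graph E" and "laplacian a Y = 0"
  shows "Y $ i = Y $ j"
proof -
  note nonneg = adjacency_matrix_nonneg[OF adj]
  have sum0: "(\<Sum>i\<in>UNIV. \<Sum>j\<in>UNIV. a $ i $ j * ((Y $ i - Y $ j) \<bullet> (Y $ i - Y $ j))) = 0"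
    using laplacian_inner[OF adjacency_matrix_sym[OF adj], of Y Y] assms(3) by simp
  have term0: "a $ i $ j * ((Y $ i - Y $ j) \<bullet> (Y $ i - Y $ j)) = 0" for i j
  proof -
    have "(\<Sum>j\<in>UNIV. a $ i $ j * ((Y $ i - Y $ j) \<bullet> (Y $ i - Y $ j))) = 0"
      using sum0 nonneg by (subst (asm) sum_nonneg_eq_0_iff) (auto intro!: sum_nonneg)
    then show ?thesis
      using nonneg by (subst (asm) sum_nonneg_eq_0_iff) auto
  qed
  have "(\<lambda>u v. {u, v} \<in> E)\<^sup>*\<^sup>* i j" using assms(2) by (simp add: connected_graph_def)
  then show ?thesis
  proof induction
    case (step u v)
    have "a $ u $ v > 0"
      using adj step(2) unfolding adjacency_matrix_def by (metis insert_commute)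
    with term0[of u v] step(3) show ?case by simp
  qed simp
qed

section \<open>Block operators of the partitioned matrices\<close>

definition gram_blocks :: "('m \<Rightarrow> 'n) \<Rightarrow> real^'r^'m \<Rightarrow> real^'q^'r^'n \<Rightarrow> real^'q^'r^'n" where
  "gram_blocks own A Y = (\<chi> i. transpose (row_block own A i) ** (row_block own A i ** Y $ i))"

text \<open>Subtracted from \<open>gram_blocks own A Y\<close>, this gives the gradient of half the
  sum of the squared local residuals.\<close>

definition data_blocks :: "('m \<Rightarrow> 'n) \<Rightarrow> real^'r^'m \<Rightarrow> real^'q^'m \<Rightarrow> real^'q^'r^'n" where
  "data_blocks own A F = (\<chi> i. transpose (row_block own A i) ** row_block own F i)"

definition mult_blocks :: "('p \<Rightarrow> 'n) \<Rightarrow> real^'q^'p \<Rightarrow> real^'p^'r \<Rightarrow> real^'q^'r^'n" where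
  "mult_blocks own B X = (\<chi> i. col_block own X i ** row_block own B i)"

definition mult_transpose_blocks :: "('p \<Rightarrow> 'n) \<Rightarrow> real^'q^'p \<Rightarrow> real^'q^'r^'n \<Rightarrow> real^'p^'r" where
  "mult_transpose_blocks own B L = join_cols own (\<lambda>i. L $ i ** transpose (row_block own B i))"

lemma linear_gram_blocks: "linear (gram_blocks own A)"
  by (rule linearI) (simp_all add: gram_blocks_def vec_eq_iff
      linear_add[OF linear_matrix_matrix_right] linear_scale[OF linear_matrix_matrix_right])

lemma col_block_add: "col_block own (X + Y) i = col_block own X i + col_block own Y i"
  by (simp add: col_block_def vec_eq_iff)

lemma col_block_scaleR: "col_block own (c *\<^sub>R X) i = c *\<^sub>R col_block own X i"
  by (simp add: col_block_def vec_eq_iff)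

lemma linear_mult_blocks: "linear (mult_blocks own B)"
  by (rule linearI)
    (simp_all add: mult_blocks_def vec_eq_iff col_block_add col_block_scaleR
      linear_add[OF linear_matrix_matrix_left] linear_scale[OF linear_matrix_matrix_left])

lemma mult_transpose_blocks_nth:
  "mult_transpose_blocks own B L $ k $ l = (\<Sum>j\<in>UNIV. L $ own l $ k $ j * B $ l $ j)"
  by (simp add: mult_transpose_blocks_def join_cols_def row_block_def matrix_matrix_mult_def
      transpose_def)

lemma linear_mult_transpose_blocks: "linear (mult_transpose_blocks own B)"
  by (rule linearI)
    (simp_all add: vec_eq_iff mult_transpose_blocks_nth sum.distrib sum_distrib_left algebra_simps)

lemma mult_blocks_nth:
  "mult_blocks own B X $ i $ k $ j = (\<Sum>l | own l = i. X $ k $ l * B $ l $ j)"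
  by (simp add: mult_blocks_def col_block_def row_block_def matrix_matrix_mult_def if_distrib
      sum.inter_filter[symmetric] cong: if_cong)

text \<open>Every index has exactly one owner, so the fibres of \<open>own\<close> partition the
  index set.\<close>

lemma sum_fibres:
  fixes own :: "'p::finite \<Rightarrow> 'n::finite"
  shows "(\<Sum>i\<in>UNIV. \<Sum>l | own l = i. f i l) = (\<Sum>l\<in>UNIV. f (own l) l)"
proof -
  have "(\<Sum>i\<in>UNIV. \<Sum>l | own l = i. f i l) = (\<Sum>i\<in>UNIV. \<Sum>l | own l = i. f (own l) l)"
    by (intro sum.cong) auto
  also have "\<dots> = (\<Sum>l\<in>UNIV. f (own l) l)"
    using sum.group[of UNIV UNIV own "\<lambda>l. f (own l) l"] by simp
  finally show ?thesis .
qed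

lemma sum_mult_blocks: "(\<Sum>i\<in>UNIV. mult_blocks own B X $ i) = X ** B"
  for own :: "'p::finite \<Rightarrow> 'n::finite"
  by (simp add: vec_eq_iff mult_blocks_nth matrix_matrix_mult_def sum_fibres)

lemma mult_blocks_adjoint: "mult_blocks own B X \<bullet> L = X \<bullet> mult_transpose_blocks own B L"
proof -
  have "mult_blocks own B X \<bullet> L
      = (\<Sum>i\<in>UNIV. \<Sum>k\<in>UNIV. \<Sum>j\<in>UNIV. \<Sum>l | own l = i. X $ k $ l * B $ l $ j * L $ i $ k $ j)"
    by (simp add: inner_vec_def mult_blocks_nth sum_distrib_right)
  also have "\<dots> = (\<Sum>k\<in>UNIV. \<Sum>j\<in>UNIV. \<Sum>i\<in>UNIV. \<Sum>l | own l = i. X $ k $ l * B $ l $ j * L $ i $ k $ j)"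
    by (subst sum.swap, intro sum.cong refl, rule sum.swap)
  also have "\<dots> = (\<Sum>k\<in>UNIV. \<Sum>j\<in>UNIV. \<Sum>l\<in>UNIV. X $ k $ l * B $ l $ j * L $ own l $ k $ j)"
    by (simp add: sum_fibres)
  also have "\<dots> = (\<Sum>k\<in>UNIV. \<Sum>l\<in>UNIV. \<Sum>j\<in>UNIV. X $ k $ l * B $ l $ j * L $ own l $ k $ j)"
    by (intro sum.cong refl sum.swap)
  also have "\<dots> = X \<bullet> mult_transpose_blocks own B L"
    by (simp add: inner_vec_def mult_transpose_blocks_nth sum_distrib_left mult_ac)
  finally show ?thesis .
qed

lemma col_block_mult_transpose_blocks:
  "col_block own (mult_transpose_blocks own B L) i = L $ i ** transpose (row_block own B i)"
  by (auto simp: vec_eq_iff col_block_def mult_transpose_blocks_nth row_block_def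
      matrix_matrix_mult_def transpose_def)

lemma gram_blocks_inner:
  "gram_blocks own A Y \<bullet> W = (\<Sum>i\<in>UNIV. (row_block own A i ** Y $ i) \<bullet> (row_block own A i ** W $ i))"
  by (subst inner_vec_def) (simp add: gram_blocks_def inner_matrix_matrix_left)

lemma gram_blocks_sym: "gram_blocks own A Y \<bullet> W = Y \<bullet> gram_blocks own A W"
  by (simp add: inner_commute[of Y] gram_blocks_inner) (simp add: inner_commute)

lemma gram_blocks_psd: "Y \<bullet> gram_blocks own A Y \<ge> 0"
  by (simp add: inner_commute[of Y] gram_blocks_inner sum_nonneg)

text \<open>A vanishing Gram form forces every local product of \<open>A\<close> and
  \<open>Y\<close> to vanish, and the pairing with the data contains these products as
  factors.\<close>

lemma data_blocks_orthogonal: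
  assumes "gram_blocks own A Y = 0"
  shows "Y \<bullet> data_blocks own A F = 0"
proof -
  have "(\<Sum>i\<in>UNIV. (row_block own A i ** Y $ i) \<bullet> (row_block own A i ** Y $ i)) = 0"
    using gram_blocks_inner[of own A Y Y] assms by simp
  then have "row_block own A i ** Y $ i = 0" for i
    by (subst (asm) sum_nonneg_eq_0_iff) auto
  then show ?thesis
    by (simp add: inner_vec_def[of Y] data_blocks_def inner_matrix_matrix_left[symmetric])
qed

lemma row_block_mult: "row_block own A i ** Y = row_block own (A ** Y) i"
  by (auto simp: vec_eq_iff row_block_def matrix_matrix_mult_def)

lemma transpose_row_block_mult:
  "(transpose (row_block own A i) ** row_block own M i) $ k $ j = (\<Sum>s | own s = i. A $ s $ k * M $ s $ j)"
  by (auto simp: row_block_def matrix_matrix_mult_def transpose_def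
      intro!: sum.mono_neutral_cong_right split: if_splits)

lemma sum_residual_blocks:
  fixes own :: "'m::finite \<Rightarrow> 'n::finite"
  assumes "\<And>i. Y $ i = y"
  shows "(\<Sum>i\<in>UNIV. (gram_blocks own A Y - data_blocks own A F) $ i) = transpose A ** (A ** y - F)"
proof -
  have "row_block own (A ** y) i - row_block own F i = row_block own (A ** y - F) i" for i
    by (simp add: row_block_def vec_eq_iff)
  then have "(gram_blocks own A Y - data_blocks own A F) $ i
      = transpose (row_block own A i) ** row_block own (A ** y - F) i" for i
    by (simp add: gram_blocks_def data_blocks_def assms row_block_mult
        linear_diff[OF linear_matrix_matrix_right, symmetric])
  then have "(\<Sum>i\<in>UNIV. (gram_blocks own A Y - data_blocks own A F) $ i) $ k $ j
      = (transpose A ** (A ** y - F)) $ k $ j" for k j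
    by (simp only: sum_component transpose_row_block_mult sum_fibres)
      (simp add: matrix_matrix_mult_def transpose_def)
  then show ?thesis by (simp only: vec_eq_iff simp_thms)
qed

section \<open>The distributed algorithm as a saddle-point flow\<close>

lemma rrr_saddle_flow:
  fixes A :: "real^'r^'m" and B :: "real^'q^'p" and F :: "real^'q^'m"
    and ownA :: "'m \<Rightarrow> 'n::finite" and ownB :: "'p \<Rightarrow> 'n" and a :: "real^'n^'n"
  assumes adj: "adjacency_matrix E a"
  shows "saddle_flow (laplacian a) (gram_blocks ownA A) (mult_blocks ownB B)
    (mult_transpose_blocks ownB B) (1 / real CARD('n)) (data_blocks ownA A F)"
  by (rule saddle_flow.intro)
    (auto intro: linear_laplacian linear_gram_blocks linear_mult_blocks linear_mult_transpose_blocks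
      laplacian_sym[OF adjacency_matrix_sym[OF adj]] laplacian_psd[OF adjacency_matrix_sym[OF adj]]
      adjacency_matrix_nonneg[OF adj]
      gram_blocks_sym gram_blocks_psd mult_blocks_adjoint data_blocks_orthogonal)

lemma rrr_field_eq_saddle_flow:
  fixes A :: "real^'r^'m" and B :: "real^'q^'p" and F :: "real^'q^'m"
    and ownA :: "'m \<Rightarrow> 'n::finite" and ownB :: "'p \<Rightarrow> 'n" and a :: "real^'n^'n"
  assumes adj: "adjacency_matrix E a"
  shows "rrr_field a ownA ownB A B F
    = (\<lambda>v. saddle_flow.flow (laplacian a) (gram_blocks ownA A) (mult_blocks ownB B)
        (mult_transpose_blocks ownB B) (1 / real CARD('n)) v
      + saddle_flow.offset (laplacian a) (1 / real CARD('n)) (data_blocks ownA A F))"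
proof (rule ext)
  fix v :: "('n, 'p, 'q, 'r) state"
  obtain X Y Z L1 L2 where fields: "v = (X, Y, Z, L1, L2)"
    by (cases v)
  define \<alpha> where "\<alpha> = 1 / real CARD('n)"
  note sf = rrr_saddle_flow[OF adj, of ownA A ownB B F, folded \<alpha>_def]
  define g where "g = data_blocks ownA A F"
  define y where "y = saddle_flow.primal (laplacian a) (gram_blocks ownA A) \<alpha> Y L1 L2"
  define d where "d = y + g"
  have dY: "- (transpose (row_block ownA A i) ** (row_block ownA A i ** Y $ i - row_block ownA F i))
      - disagreement a (($) Y) i - \<alpha> *\<^sub>R L1 $ i - disagreement a (($) L2) i
      = d $ i" for i
    by (simp add: d_def y_def g_def saddle_flow.primal_def[OF sf] gram_blocks_def data_blocks_def
        linear_diff[OF linear_matrix_matrix_right])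
  have X: "join_cols ownB (\<lambda>i. L1 $ i ** transpose (row_block ownB B i))
      = mult_transpose_blocks ownB B L1"
    by (simp add: mult_transpose_blocks_def)
  \<comment> \<open>The column blocks of the joined X-velocity are the local velocities, so the
    local feedback is a block of one global expression.\<close>
  have C: "(col_block ownB X i + L1 $ i ** transpose (row_block ownB B i)) ** row_block ownB B i
      = mult_blocks ownB B (X + mult_transpose_blocks ownB B L1) $ i" for i
    by (simp add: mult_blocks_def col_block_add col_block_mult_transpose_blocks)
  have "rrr_field a ownA ownB A B F v
      = (mult_transpose_blocks ownB B L1, d, - laplacian a L1,
        \<alpha> *\<^sub>R (Y + d) - mult_blocks ownB B (X + mult_transpose_blocks ownB B L1)
        + laplacian a Z - laplacian a L1, laplacian a Y + laplacian a d)"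
    unfolding fields rrr_field_def Let_def prod.case \<alpha>_def[symmetric] dY X C
    by (auto simp: vec_eq_iff[where 'b='n])
  also have "\<dots> = saddle_flow.flow (laplacian a) (gram_blocks ownA A) (mult_blocks ownB B)
        (mult_transpose_blocks ownB B) \<alpha> v + saddle_flow.offset (laplacian a) \<alpha> g"
    unfolding fields saddle_flow.flow_def[OF sf] saddle_flow.offset_def[OF sf[folded g_def]] prod.case
      y_def[symmetric]
    by (simp add: d_def scaleR_add_right linear_add[OF linear_laplacian])
  finally show "rrr_field a ownA ownB A B F v
      = saddle_flow.flow (laplacian a) (gram_blocks ownA A) (mult_blocks ownB B)
          (mult_transpose_blocks ownB B) (1 / real CARD('n)) v
        + saddle_flow.offset (laplacian a) (1 / real CARD('n)) (data_blocks ownA A F)"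
    by (simp add: \<alpha>_def g_def)
qed

section \<open>From equilibria to least squares solutions\<close>

lemma equilibrium_least_squares:
  fixes A :: "real^'r^'m" and B :: "real^'q^'p" and F :: "real^'q^'m"
    and ownA :: "'m \<Rightarrow> 'n::finite" and ownB :: "'p \<Rightarrow> 'n" and a :: "real^'n^'n"
  assumes adj: "adjacency_matrix E a" and con: "connected_graph E"
    and eq: "equilibrium (rrr_field a ownA ownB A B F) (X, Y, Z, L1, L2)"
  shows "least_squares_solution A B F X"
proof (rule least_squares_of_normal_equation)
  note cond = saddle_flow.equilibrium_conditions[OF rrr_saddle_flow[OF adj]
      eq[unfolded rrr_field_eq_saddle_flow[OF adj]]]
  note sum_lap = sum_laplacian[OF adjacency_matrix_sym[OF adj]]
  note consensus = laplacian_kernel_consensus[OF adj con]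
  \<comment> \<open>Any agent may represent the common values of \<open>Y\<close> and
    \<open>L1\<close>.\<close>
  fix i0 :: 'n
  define y l where "y = Y $ i0" and "l = L1 $ i0"
  have y: "Y $ i = y" and l: "L1 $ i = l" for i
    using consensus[OF cond(3)] consensus[OF cond(2)] by (auto simp: y_def l_def)
  have avg: "(\<Sum>i\<in>(UNIV::'n set). (1 / real CARD('n)) *\<^sub>R x) = x" for x :: "real^'q^'r"
    by (simp add: sum_constant_scaleR del: sum_constant)
  \<comment> \<open>Summing over the agents removes the Laplacian term; the factor
    \<open>1 / n\<close> averages the common \<open>y\<close>, which must equal
    \<open>X ** B\<close>.\<close>
  have "(\<Sum>i\<in>UNIV. ((1 / real CARD('n)) *\<^sub>R Y - mult_blocks ownB B X + laplacian a Z) $ i) = 0"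
    unfolding cond(4) by simp
  then have "y - X ** B = 0"
    unfolding vector_add_component vector_minus_component sum.distrib sum_subtractf sum_lap
      sum_mult_blocks vector_scaleR_component y avg by simp
  then have yX: "y = X ** B" by simp
  \<comment> \<open>The same summation of the gradient condition identifies the common multiplier
    with minus the global gradient; multiplying by \<open>transpose B\<close> annihilates
    it.\<close>
  have "(\<Sum>i\<in>UNIV. (gram_blocks ownA A Y - data_blocks ownA A F + (1 / real CARD('n)) *\<^sub>R L1
      + laplacian a L2) $ i) = 0"
    unfolding cond(5) by simp
  then have "transpose A ** (A ** y - F) + l = 0"
    unfolding vector_add_component sum.distrib sum_lap sum_residual_blocks[OF y]
      vector_scaleR_component l avg by simp
  then have "transpose A ** (A ** X ** B - F) = - l"
    by (simp add: yX matrix_mul_assoc eq_neg_iff_add_eq_0)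
  moreover have "l ** transpose B = 0"
    using cond(1) by (simp add: vec_eq_iff mult_transpose_blocks_nth l matrix_matrix_mult_def transpose_def)
  ultimately show "transpose A ** (A ** X ** B - F) ** transpose B = 0"
    by (simp add: linear_neg[OF linear_matrix_matrix_left])
qed

theorem mainTheorem5:
  fixes A :: "real^'r^'m" and B :: "real^'q^'p" and F :: "real^'q^'m"
    and ownA :: "'m \<Rightarrow> 'n::finite" and ownB :: "'p \<Rightarrow> 'n"
    and E :: "'n set set" and a :: "real^'n^'n"
    and f :: "('n, 'p, 'q, 'r) state \<Rightarrow> ('n, 'p, 'q, 'r) state"
  assumes "undirected_graph E" and "adjacency_matrix E a" and "connected_graph E"
    and f: "f = rrr_field a ownA ownB A B F"
  shows
    "((\<forall>z. equilibrium f z \<longrightarrow> lyapunov_stable f z) \<and>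
      (\<forall>\<phi>. solution f \<phi> \<longrightarrow> bounded (\<phi> ` {0..})))
     \<and>
     (\<forall>\<phi>. solution f \<phi> \<longrightarrow>
        (\<exists>z. equilibrium f z \<and> converges_exponentially \<phi> z) \<and>
        (\<exists>Xs. least_squares_solution A B F Xs \<and>
              converges_exponentially (\<lambda>t. fst (\<phi> t)) Xs))"
proof -
  note f_eq = f[unfolded rrr_field_eq_saddle_flow[OF assms(2)]]
  note sf = rrr_saddle_flow[OF assms(2)]
  have stable: "lyapunov_stable f z" if "equilibrium f z" for z
    using saddle_flow.flow_stable[OF sf] that unfolding f_eq by blast
  have conv: "\<exists>z. equilibrium f z \<and> converges_exponentially \<phi> z" if "solution f \<phi>" for \<phi>
    using saddle_flow.flow_convergent[OF sf] that unfolding f_eq by blast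
  have conv_X: "\<exists>Xs. least_squares_solution A B F Xs \<and> converges_exponentially (\<lambda>t. fst (\<phi> t)) Xs"
    if sol: "solution f \<phi>" for \<phi>
  proof -
    obtain X Y Z L1 L2
      where z: "equilibrium f (X, Y, Z, L1, L2)" "converges_exponentially \<phi> (X, Y, Z, L1, L2)"
      using conv[OF sol] by (metis prod.collapse)
    \<comment> \<open>Projection to the first component does not increase distances, so it inherits
      the exponential rate.\<close>
    have "dist (fst (\<phi> t)) X \<le> dist (\<phi> t) (X, Y, Z, L1, L2)" for t
      using dist_fst_le[of "\<phi> t" "(X, Y, Z, L1, L2)"] by simp
    then have "converges_exponentially (\<lambda>t. fst (\<phi> t)) X"
      using z(2) unfolding converges_exponentially_def by (meson order_trans)
    then show ?thesis
      using equilibrium_least_squares[OF assms(2,3) z(1)[unfolded f]] by blast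
  qed
  show ?thesis
    using stable conv conv_X converges_exponentially_bounded by blast
qed

end
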